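(* Let $T$ be a tree with $n$ vertices. If $n\ge 2$, then $$\frac{13}{30} < \mathcal{P}(T) < \frac{17}{30},$$ where $\mathcal{P}(T)$ is the probability that the first player wins the tree search game on $T$ when both players play uniformly at random.
   Context: A tree is a connected acyclic undirected graph with a finite, positive number of vertices; $|T|$ is the number of vertices of $T$; $T\smallsetminus v$ is the forest obtained by deleting $v$ and its incident edges. Tree search game on $T$: one vertex of $T$ is selected uniformly at random as the target, unknown to both players. The players alternately guess vertices. If the guess $v$ is the target, the player who made it wins. Otherwise both players are informed which component of $T\smallsetminus v$ contains the target, and the game continues on that component with the other player to move. $\mathcal{P}(T)$ is the probability that the first player wins on $T$ when both players always choose a vertex uniformly at random from among the vertices that could still be the target. Equivalently, with $n=|T|$, it is determined recursively by $$\mathcal{P}(T)=1-\frac1{n^2}\sum_{v\in V(T)}\sum_{T'}|T'|\,\mathcal{P}(T'),$$ where $T'$ ranges over the components of $T\smallsetminus v$ (empty sums are $0$). *)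

theory Defs
  imports "HOL-Probability.Probability_Mass_Function" "Graph_Theory.Digraph_Component"
begin

text \<open>
  As usual in Graph_Theory, a simple undirected graph is a finite, symmetric, loop-free digraph
  without multiple arcs (locale \<open>graph\<close>). The library's predicate \<open>tree\<close> is not suitable for such
  graphs: every edge between \<open>a\<close> and \<open>b\<close> gives rise to the directed cycle \<open>a, b, a\<close>. The cycles
  of the undirected graph are exactly the directed cycles of length at least 3. Nonemptiness is
  part of \<^const>\<open>connected\<close>.
\<close>

definition undirected_tree :: "('a, 'b) pre_digraph \<Rightarrow> bool" where
  "undirected_tree T \<longleftrightarrow>
     graph T \<and> connected T \<and> \<not> (\<exists>p. pre_digraph.cycle T p \<and> length p \<ge> 3)"

text \<open>
  The component of \<open>G\<close> containing \<open>u\<close>, as a graph. In a symmetric digraph the strongly connected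
  components are the components of the undirected graph.
\<close>

definition component_of :: "('a, 'b) pre_digraph \<Rightarrow> 'a \<Rightarrow> ('a, 'b) pre_digraph" where
  "component_of G u = G \<restriction> pre_digraph.scc_of G u"

text \<open>
  The random play on \<open>T\<close> with target \<open>t\<close>: the outcome is \<^const>\<open>True\<close> iff the player who is to move
  on \<open>T\<close> wins. After a wrong guess it is the opponent who moves first on the remaining component,
  hence the negation. The final branch is a junk value, never reached from a finite graph
  containing the target.
\<close>

function random_play :: "('a, 'b) pre_digraph \<Rightarrow> 'a \<Rightarrow> bool pmf" where
  "random_play T t =
     (if finite (verts T) \<and> t \<in> verts T
      then bind_pmf (pmf_of_set (verts T)) (\<lambda>v.
             if v = t then return_pmf True
             else map_pmf Not (random_play (component_of (pre_digraph.del_vert T v) t) t))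
      else return_pmf False)"
  by pat_completeness auto
termination
proof (relation "Wellfounded.measure (\<lambda>(T, t). card (verts T))", goal_cases)
  case 1
  show ?case by simp
next
  case (2 T t v)
  have fin: "finite (verts T)" using 2 by simp
  have "verts T \<noteq> {}" using 2 by blast
  hence v: "v \<in> verts T" using 2 set_pmf_of_set[OF _ fin] by blast
  have "pre_digraph.scc_of (pre_digraph.del_vert T v) t \<subseteq> verts T - {v}"
    by (auto simp: pre_digraph.scc_of_def reachable_def pre_digraph.verts_del_vert
        dest: in_rtrancl_on_in_F)
  hence "verts (component_of (pre_digraph.del_vert T v) t) \<subset> verts T"
    using v by (auto simp: component_of_def)
  thus ?case using fin by (simp add: psubset_card_mono)
qed

declare random_play.simps [simp del]

text \<open>
  The probability that the first player wins when the target is uniformly random and both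
  players play uniformly at random.
\<close>

definition first_player_win_prob :: "('a, 'b) pre_digraph \<Rightarrow> real" where
  "first_player_win_prob T =
     measure_pmf.prob (bind_pmf (pmf_of_set (verts T)) (random_play T)) {True}"

end

theory Submission
  imports Defs
begin

text \<open>
  Let \<open>P\<close> be the probability that the first player wins on a tree \<open>S\<close> with \<open>n\<close> vertices, and let
  \<open>A S = n (2 P - 1)\<close>. In terms of \<open>A\<close> the recursion for \<open>P\<close> reads
  \<open>A S = 1 - (1/n) \<Sum> A C\<close>, where the sum runs over all first guesses \<open>v\<close> and all components
  \<open>C\<close> of \<open>S\<close> without \<open>v\<close>. These components correspond to the directed edges \<open>(v, u)\<close> of \<open>S\<close>, with \<open>C\<close>
  the component that contains \<open>u\<close>. The claim becomes \<open>|A S| < 2/15 n\<close> for \<open>n \<ge> 2\<close>, while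
  \<open>A S = 1\<close> for \<open>n = 1\<close>.

  The proof is a simultaneous induction for the upper bound \<open>A S < 2/15 n\<close> (for \<open>n \<ge> 2\<close>) and the
  lower bound \<open>A S \<ge> 17/15 - 13/15 * L/n - 2/15 n\<close>, where \<open>L\<close> is the number of leaves of \<open>S\<close>
  (\<open>advantage_bounds\<close>). The lower bound follows from the upper bound for the components: for each
  \<open>v\<close> their sizes add up to \<open>n - 1\<close>, and the exceptional components with a single vertex are
  in bijection with the leaves (\<open>advantage_lower_step\<close>).

  Conversely, inserting the lower bound for the components gives \<open>A S < 2/15 n\<close> once the sum of
  \<open>17/15 - 13/15 * leaf_ratio C\<close> over all components \<open>C\<close> exceeds \<open>13/15 n\<close>. There are \<open>2 (n - 1)\<close>
  of them, so the components must not consist mostly of leaves. To see this, pair the two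
  components at the ends of an edge (\<open>leaf_ratio_opposite_branches\<close>). They partition \<open>S\<close> and
  together have at most \<open>L + 2\<close> leaves, so the sum of their leaf ratios is at most
  \<open>1 + L/(n - 2)\<close>; at an edge that ends in a leaf it is at most 1, because a single vertex has no
  leaves. As \<open>L\<close> of the \<open>n - 1\<close> edges end in a leaf, the ratios sum to at most
  \<open>(n - 1) + L (n - 1 - L)/(n - 2)\<close>, which is small enough for \<open>n \<ge> 5\<close>
  (\<open>advantage_upper_large\<close>). For \<open>n \<le> 4\<close>, all components have nonnegative advantage, and the
  single-vertex components alone suffice (\<open>advantage_upper_small\<close>).
\<close>

section \<open>A bound for two complementary leaf ratios\<close>

text \<open>
  This controls the leaf ratios of the two sides of an edge that have \<open>a\<close> and \<open>b\<close> vertices and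
  \<open>p\<close> and \<open>q\<close> leaves, in a tree with \<open>l\<close> leaves. A leaf weighs more on the smaller side, so the
  extreme case makes every vertex of the smaller side a leaf, and among those cases the worst one
  has a smaller side of size 2.
\<close>

lemma two_sides_ratio_bound:
  fixes a b p q l :: real
  assumes "2 \<le> a" "2 \<le> b" "0 \<le> p" "0 \<le> q" "p \<le> a" "q \<le> b" "p + q \<le> l + 2" "0 \<le> l" "l \<le> a + b - 2"
  shows "p / a + q / b \<le> 1 + l / (a + b - 2)"
  using assms
proof (induction a b arbitrary: p q rule: linorder_wlog)
  case (le a b)
  have "p / a + q / b \<le> p / a + min b (l + 2 - p) / b"
    using le by (intro add_left_mono divide_right_mono) auto
  also have "\<dots> \<le> 1 + l / (a + b - 2)"
  proof (cases "l + 2 \<le> a")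
    case True
    \<comment> \<open>There are too few leaves to fill even the smaller side \<open>a\<close>.\<close>
    have "p / a + min b (l + 2 - p) / b \<le> p / a + (l + 2 - p) / a"
      using le True by (intro add_left_mono frac_le) auto
    also have "\<dots> = (l + 2) / a" by (simp add: add_divide_distrib[symmetric])
    also have "\<dots> \<le> 1" using True le by simp
    also have "\<dots> \<le> 1 + l / (a + b - 2)" using le by simp
    finally show ?thesis .
  next
    case False
    have "p / a + min b (l + 2 - p) / b \<le> p / a + (l + 2 - p) / b"
      using le by (intro add_left_mono divide_right_mono) auto
    also have "\<dots> = 1 + (l + 2 - a) / b - (a - p) * (1 / a - 1 / b)"
      using le by (simp add: field_simps)
    also have "\<dots> \<le> 1 + (l + 2 - a) / b"
    proof -
      have "0 \<le> (a - p) * (1 / a - 1 / b)"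
        using le by (intro mult_nonneg_nonneg) (auto simp: frac_le)
      then show ?thesis by simp
    qed
    also have "(l + 2 - a) / b \<le> l / (a + b - 2)"
    proof -
      have "l * (a - 2) \<le> (a + b - 2) * (a - 2)"
        using le by (intro mult_right_mono) auto
      then have "(l + 2 - a) * (a + b - 2) \<le> l * b"
        by (simp add: algebra_simps)
      then show ?thesis using le by (simp add: divide_le_eq pos_le_divide_eq mult.commute field_simps)
    qed
    finally show ?thesis by simp
  qed
  finally show ?case .
next
  case (sym a b)
  have "q / b + p / a \<le> 1 + l / (b + a - 2)"
    by (rule sym.IH) (use sym.prems in \<open>simp_all add: add.commute\<close>)
  then show ?case by (simp add: add.commute)
qed

section \<open>Subtrees of a finite forest\<close>

text \<open>
  Acyclicity in the form in which it is used: after deletion of a vertex, its neighbours lie in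
  different components. The property passes to all vertex subsets, so the positions of the
  game can be treated as subsets of one fixed vertex set, with reachability restricted to them.
\<close>

locale finite_forest =
  fixes V :: "'a set" and E :: "'a rel"
  assumes finite_V: "finite V"
    and sym_E: "sym E"
    and irrefl_E: "(v, v) \<notin> E"
    and no_bypass: "(v, u) \<in> E \<Longrightarrow> (v, u') \<in> E \<Longrightarrow> u \<noteq> u' \<Longrightarrow> (u, u') \<notin> rtrancl_on (V - {v}) E"
begin

definition subtree :: "'a set \<Rightarrow> bool" where
  "subtree S \<longleftrightarrow> S \<subseteq> V \<and> S \<noteq> {} \<and> (\<forall>x\<in>S. \<forall>y\<in>S. (x, y) \<in> rtrancl_on S E)"

definition nbrs :: "'a set \<Rightarrow> 'a \<Rightarrow> 'a set" where
  "nbrs S v = {u \<in> S. (v, u) \<in> E}"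

text \<open>
  Every undirected edge occurs in both directions; the pair \<open>(v, u)\<close> stands for the component
  that contains \<open>u\<close> after the deletion of \<open>v\<close>, called \<open>branch S v u\<close> below.
\<close>

definition edges :: "'a set \<Rightarrow> ('a \<times> 'a) set" where
  "edges S = Sigma S (nbrs S)"

definition leaves :: "'a set \<Rightarrow> 'a set" where
  "leaves S = {u \<in> S. card (nbrs S u) = 1}"

definition component :: "'a set \<Rightarrow> 'a \<Rightarrow> 'a set" where
  "component S u = {w. (u, w) \<in> rtrancl_on S E}"

abbreviation branch :: "'a set \<Rightarrow> 'a \<Rightarrow> 'a \<Rightarrow> 'a set" where
  "branch S v u \<equiv> component (S - {v}) u"

lemma E_commute: "(u, v) \<in> E \<longleftrightarrow> (v, u) \<in> E"
  using sym_E by (auto dest: symD)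

lemma reach_commute: "(u, v) \<in> rtrancl_on S E \<longleftrightarrow> (v, u) \<in> rtrancl_on S E"
  using rtrancl_on_sym[OF sym_E] by (auto dest: symD)

lemma finite_subtree: "subtree S \<Longrightarrow> finite S"
  using finite_V by (auto simp: subtree_def intro: finite_subset)

lemma card_subtree_pos: "subtree S \<Longrightarrow> 1 \<le> card S"
  using finite_subtree[of S] by (auto simp: subtree_def Suc_le_eq card_gt_0_iff)

lemma finite_nbrs: "finite S \<Longrightarrow> finite (nbrs S v)"
  by (simp add: nbrs_def)

lemma finite_edges: "finite S \<Longrightarrow> finite (edges S)"
  by (auto simp: edges_def finite_nbrs intro!: finite_SigmaI)

lemma in_edges_iff: "(v, u) \<in> edges S \<longleftrightarrow> v \<in> S \<and> u \<in> S \<and> (v, u) \<in> E"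
  by (auto simp: edges_def nbrs_def)

lemma edges_commute: "(v, u) \<in> edges S \<longleftrightarrow> (u, v) \<in> edges S"
  by (auto simp: in_edges_iff E_commute)

lemma component_subset: "component S u \<subseteq> S"
  by (auto simp: component_def dest: in_rtrancl_on_in_F)

lemma self_in_component: "u \<in> S \<Longrightarrow> u \<in> component S u"
  by (simp add: component_def)

lemma component_step: "w \<in> component S u \<Longrightarrow> (w, w') \<in> E \<Longrightarrow> w' \<in> S \<Longrightarrow> w' \<in> component S u"
  by (auto simp: component_def intro: rtrancl_on_into_rtrancl_on)

lemma component_eq: "w \<in> component S u \<Longrightarrow> component S w = component S u"
  by (auto simp: component_def intro: rtrancl_on_trans reach_commute[THEN iffD1])

lemma reach_mono: "(u, w) \<in> rtrancl_on S E \<Longrightarrow> S \<subseteq> S' \<Longrightarrow> (u, w) \<in> rtrancl_on S' E"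
  by (induction rule: rtrancl_on_induct) (auto intro: rtrancl_on_into_rtrancl_on)

lemma subtree_component:
  assumes "S \<subseteq> V" "u \<in> S"
  shows "subtree (component S u)"
proof -
  have reach: "(u, w) \<in> rtrancl_on (component S u) E" if "w \<in> component S u" for w
    using that[unfolded component_def mem_Collect_eq]
  proof (induction rule: rtrancl_on_induct)
    case base
    then show ?case using assms by (simp add: self_in_component)
  next
    case (step y z)
    then have "z \<in> component S u"
      by (auto simp: component_def intro: rtrancl_on_into_rtrancl_on)
    then show ?case using step by (blast intro: rtrancl_on_into_rtrancl_on)
  qed
  have "(x, y) \<in> rtrancl_on (component S u) E" if "x \<in> component S u" "y \<in> component S u" for x y
    by (rule rtrancl_on_trans[OF reach[OF that(1), THEN reach_commute[THEN iffD1]] reach[OF that(2)]])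
  then show ?thesis
    using assms component_subset[of S u] self_in_component[of u S] unfolding subtree_def by blast
qed

lemma nbr_unique_in_branch:
  assumes "S \<subseteq> V" "(v, u) \<in> E" "w \<in> branch S v u" "(v, w) \<in> E"
  shows "w = u"
proof (rule ccontr)
  assume "w \<noteq> u"
  moreover have "(u, w) \<in> rtrancl_on (V - {v}) E"
    using assms by (auto simp: component_def intro: reach_mono)
  ultimately show False using no_bypass assms by blast
qed

lemma UN_branch:
  assumes "subtree S" "v \<in> S"
  shows "(\<Union>u\<in>nbrs S v. branch S v u) = S - {v}"
proof
  show "(\<Union>u\<in>nbrs S v. branch S v u) \<subseteq> S - {v}"
    using component_subset by blast
  have "w = v \<or> (\<exists>u\<in>nbrs S v. w \<in> branch S v u)" if "(v, w) \<in> rtrancl_on S E" for w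
    using that
  proof (induction rule: rtrancl_on_induct)
    case (step y z)
    show ?case
    proof (cases "y = v")
      case True
      then show ?thesis
        using step by (cases "z = v") (auto simp: nbrs_def intro!: self_in_component)
    next
      case False
      then show ?thesis using step by (cases "z = v") (auto intro: component_step)
    qed
  qed simp
  then show "S - {v} \<subseteq> (\<Union>u\<in>nbrs S v. branch S v u)"
    using assms unfolding subtree_def by blast
qed

lemma branch_disjoint:
  assumes "S \<subseteq> V" "u \<in> nbrs S v" "u' \<in> nbrs S v" "u \<noteq> u'"
  shows "branch S v u \<inter> branch S v u' = {}"
proof (rule ccontr)
  assume "branch S v u \<inter> branch S v u' \<noteq> {}"
  then obtain w where "w \<in> branch S v u" "w \<in> branch S v u'" by blast
  then have "branch S v u = branch S v u'" using component_eq by metis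
  moreover have "u' \<in> S - {v}" using assms irrefl_E by (auto simp: nbrs_def)
  ultimately have "u' \<in> branch S v u" using self_in_component[of u' "S - {v}"] by simp
  then show False using assms nbr_unique_in_branch[of S v u u'] by (auto simp: nbrs_def)
qed

lemma sum_over_branches:
  fixes f :: "'a \<Rightarrow> 'b::comm_monoid_add"
  assumes "subtree S" "v \<in> S"
  shows "(\<Sum>u\<in>nbrs S v. \<Sum>w\<in>branch S v u. f w) = (\<Sum>w\<in>S - {v}. f w)"
proof -
  have "S \<subseteq> V" "finite S" using assms finite_subtree by (auto simp: subtree_def)
  then have "(\<Sum>u\<in>nbrs S v. \<Sum>w\<in>branch S v u. f w) = sum f (\<Union>u\<in>nbrs S v. branch S v u)"
    using component_subset[of "S - {v}"]
    by (intro sum.UNION_disjoint[symmetric] ballI impI branch_disjoint finite_nbrs)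
       (auto intro: finite_subset)
  then show ?thesis using UN_branch[OF assms] by simp
qed

text \<open>
  Cutting an edge splits the tree into the two branches at its ends. A walk from \<open>v\<close> can only
  change sides across the edge, since \<open>v\<close> has no other neighbour in the branch on the side of \<open>u\<close>;
  this gives disjointness.
\<close>

lemma opposite_branches:
  assumes "subtree S" "(v, u) \<in> edges S"
  shows "branch S v u \<union> branch S u v = S" "branch S v u \<inter> branch S u v = {}"
proof -
  have vu: "v \<in> S" "u \<in> S" "(v, u) \<in> E" "v \<noteq> u" and S: "S \<subseteq> V"
    using assms irrefl_E by (auto simp: in_edges_iff subtree_def)
  have uS: "u \<in> branch S v u" and vS: "v \<in> branch S u v"
    using vu by (auto intro: self_in_component)
  have "w \<in> branch S v u \<union> branch S u v" if "(v, w) \<in> rtrancl_on S E" for w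
    using that
  proof (induction rule: rtrancl_on_induct)
    case (step y z)
    then show ?case
      using uS vS component_step[of y "S - {v}" u z] component_step[of y "S - {u}" v z] by blast
  qed (use vS in simp)
  then show "branch S v u \<union> branch S u v = S"
    using assms vu component_subset[of "S - {v}" u] component_subset[of "S - {u}" v]
    unfolding subtree_def by blast
  have "w \<notin> branch S v u" if "(v, w) \<in> rtrancl_on (S - {u}) E" for w
    using that
  proof (induction rule: rtrancl_on_induct)
    case base
    then show ?case using component_subset by fast
  next
    case (step y z)
    show ?case
    proof
      assume z: "z \<in> branch S v u"
      show False
      proof (cases "y = v")
        case True
        then have "z = u" using nbr_unique_in_branch[OF S vu(3) z] step by simp
        then show False using step by simp
      next
        case False
        then have "y \<in> branch S v u"
          using z step E_commute by (blast intro: component_step)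
        then show False using step by simp
      qed
    qed
  qed
  then show "branch S v u \<inter> branch S u v = {}" by (auto simp: component_def)
qed

lemma sum_edges_commute:
  fixes f :: "'a \<Rightarrow> 'a \<Rightarrow> 'b::comm_monoid_add"
  shows "(\<Sum>(v, u)\<in>edges S. f v u) = (\<Sum>(v, u)\<in>edges S. f u v)"
  by (rule sum.reindex_bij_witness[of _ prod.swap prod.swap])
     (auto simp: edges_commute split: prod.splits)

lemma sum_edges:
  fixes f :: "'a \<Rightarrow> 'a \<Rightarrow> 'b::comm_monoid_add"
  assumes "finite S"
  shows "(\<Sum>(v, u)\<in>edges S. f v u) = (\<Sum>v\<in>S. \<Sum>u\<in>nbrs S v. f v u)"
  unfolding edges_def using assms by (intro sum.Sigma[symmetric]) (auto simp: finite_nbrs)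

lemma sum_card_branches:
  assumes "subtree S"
  shows "(\<Sum>(v, u)\<in>edges S. card (branch S v u)) = card S * (card S - 1)"
proof -
  have "(\<Sum>u\<in>nbrs S v. card (branch S v u)) = card S - 1" if "v \<in> S" for v
    using sum_over_branches[OF assms that, of "\<lambda>_. 1::nat"] that finite_subtree[OF assms]
    by simp
  then show ?thesis
    by (simp add: sum_edges[OF finite_subtree[OF assms]])
qed

lemma card_opposite_branches:
  assumes "subtree S" "(v, u) \<in> edges S"
  shows "card (branch S v u) + card (branch S u v) = card S"
proof -
  have "finite S" using assms finite_subtree by blast
  then have "finite (branch S v u)" "finite (branch S u v)"
    using component_subset[of "S - {v}" u] component_subset[of "S - {u}" v] by (auto intro: finite_subset)
  then show ?thesis using opposite_branches[OF assms] card_Un_disjoint by metis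
qed

text \<open>
  Double counting: by \<open>sum_card_branches\<close> the branch sizes add up to \<open>n (n - 1)\<close>, while each edge
  with its two directions contributes \<open>n\<close> to this sum.
\<close>

lemma card_edges:
  assumes "subtree S"
  shows "card (edges S) = 2 * (card S - 1)"
proof -
  have "card S * card (edges S) = (\<Sum>(v, u)\<in>edges S. card (branch S v u) + card (branch S u v))"
    using card_opposite_branches[OF assms]
    by (subst sum.cong[where B = "edges S" and h = "\<lambda>_. card S"]) auto
  also have "\<dots> = (\<Sum>(v, u)\<in>edges S. card (branch S v u)) + (\<Sum>(v, u)\<in>edges S. card (branch S u v))"
    by (simp add: case_prod_beta sum.distrib)
  also have "\<dots> = card S * (2 * (card S - 1))"
    using sum_card_branches[OF assms] sum_edges_commute[of "\<lambda>v u. card (branch S v u)" S] by simp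
  finally show ?thesis using card_subtree_pos[OF assms] by simp
qed

section \<open>Leaves\<close>

lemma finite_leaves: "finite S \<Longrightarrow> finite (leaves S)"
  by (simp add: leaves_def)

lemma card_leaves_le: "finite S \<Longrightarrow> card (leaves S) \<le> card S"
  by (auto simp: leaves_def intro: card_mono)

lemma sum_leaf_tails:
  assumes "finite S"
  shows "(\<Sum>(v, u)\<in>edges S. of_bool (v \<in> leaves S) :: 'b::semiring_1) = of_nat (card (leaves S))"
proof -
  have "(\<Sum>(v, u)\<in>edges S. of_bool (v \<in> leaves S) :: 'b)
      = (\<Sum>v\<in>S. of_nat (card (nbrs S v)) * of_bool (v \<in> leaves S))"
    by (simp add: sum_edges[OF assms])
  also have "\<dots> = (\<Sum>v\<in>S. of_bool (v \<in> leaves S))"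
    by (intro sum.cong) (auto simp: leaves_def)
  also have "\<dots> = (\<Sum>v\<in>leaves S. 1)"
    using assms by (intro sum.mono_neutral_cong_right) (auto simp: leaves_def)
  finally show ?thesis by simp
qed

lemma sum_leaf_heads:
  assumes "finite S"
  shows "(\<Sum>(v, u)\<in>edges S. of_bool (u \<in> leaves S) :: 'b::semiring_1) = of_nat (card (leaves S))"
  using sum_leaf_tails[OF assms, where 'b = 'b]
    sum_edges_commute[of "\<lambda>v u. of_bool (v \<in> leaves S) :: 'b" S] by simp

lemma sum_degree:
  assumes "subtree S"
  shows "(\<Sum>v\<in>S. card (nbrs S v)) = 2 * (card S - 1)"
  using card_edges[OF assms] finite_subtree[OF assms]
  by (simp add: edges_def finite_nbrs)

lemma degree_pos:
  assumes "subtree S" "2 \<le> card S" "v \<in> S"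
  shows "1 \<le> card (nbrs S v)"
proof -
  have "S - {v} \<noteq> {}"
  proof
    assume "S - {v} = {}"
    then have "S = {v}" using assms by auto
    then have "card S = 1" by simp
    then show False using assms by simp
  qed
  then have "nbrs S v \<noteq> {}" using UN_branch[OF assms(1,3)] by auto
  then show ?thesis using finite_nbrs[OF finite_subtree[OF assms(1)]]
    by (simp add: Suc_le_eq card_gt_0_iff)
qed

text \<open>
  All degrees are at least 1 and their sum is \<open>2 n - 2\<close>, so at least two of them equal 1.
\<close>

lemma two_leaves:
  assumes "subtree S" "2 \<le> card S"
  shows "2 \<le> card (leaves S)"
proof -
  have fin: "finite S" using assms finite_subtree by blast
  have "2 * card S = (\<Sum>v\<in>S. 2)" by simp
  also have "\<dots> \<le> (\<Sum>v\<in>S. card (nbrs S v) + of_bool (v \<in> leaves S))"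
  proof (rule sum_mono)
    fix v assume "v \<in> S"
    then show "2 \<le> card (nbrs S v) + of_bool (v \<in> leaves S)"
      using degree_pos[OF assms, of v] by (cases "card (nbrs S v) = 1") (auto simp: leaves_def)
  qed
  also have "\<dots> = 2 * (card S - 1) + card (leaves S)"
    using sum_degree[OF assms(1)] fin
    by (simp add: sum.distrib sum.inter_filter[symmetric] of_bool_def Int_def leaves_def)
  finally show ?thesis using assms by simp
qed

text \<open>
  If all degrees were 1, their sum \<open>2 n - 2\<close> would equal \<open>n\<close>, which forces \<open>n = 2\<close>.
\<close>

lemma card_leaves_less:
  assumes "subtree S" "3 \<le> card S"
  shows "card (leaves S) < card S"
proof (rule ccontr)
  have fin: "finite S" using assms finite_subtree by blast
  assume "\<not> ?thesis"
  then have "leaves S = S"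
    using fin card_leaves_le[OF fin] by (intro card_seteq) (auto simp: leaves_def)
  then have "card (nbrs S v) = 1" if "v \<in> S" for v using that by (auto simp: leaves_def)
  then have "(\<Sum>v\<in>S. card (nbrs S v)) = card S" by simp
  then show False using sum_degree[OF assms(1)] assms(2) by simp
qed

text \<open>
  Cutting the edge between \<open>v\<close> and \<open>u\<close> changes, inside the branch of \<open>u\<close>, only the degree of \<open>u\<close>.
  Hence \<open>u\<close> is the only possible new leaf.
\<close>

lemma nbrs_branch:
  assumes "subtree S" "(v, u) \<in> edges S" "w \<in> branch S v u"
  shows "nbrs S w = nbrs (branch S v u) w \<union> (if w = u then {v} else {})"
proof -
  have vu: "v \<in> S" "u \<in> S" "(v, u) \<in> E" and S: "S \<subseteq> V"
    using assms by (auto simp: in_edges_iff subtree_def)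
  have "z \<in> branch S v u" if "z \<in> S" "(w, z) \<in> E" "z \<noteq> v" for z
    using that assms(3) by (auto intro: component_step)
  moreover have "(w, v) \<in> E \<longleftrightarrow> w = u"
    using nbr_unique_in_branch[OF S vu(3) assms(3)] vu(3) E_commute by blast
  moreover have "branch S v u \<subseteq> S" using component_subset by blast
  ultimately show ?thesis using vu unfolding nbrs_def by (cases "w = u") auto
qed

lemma leaves_branch_subset:
  assumes "subtree S" "(v, u) \<in> edges S"
  shows "leaves (branch S v u) \<subseteq> insert u (leaves S \<inter> branch S v u)"
proof
  fix w assume "w \<in> leaves (branch S v u)"
  then have w: "w \<in> branch S v u" "card (nbrs (branch S v u) w) = 1"
    by (auto simp: leaves_def)
  moreover have "w \<in> S" using w(1) component_subset by blast
  ultimately show "w \<in> insert u (leaves S \<inter> branch S v u)"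
    using nbrs_branch[OF assms w(1)] by (auto simp: leaves_def)
qed

text \<open>
  The leaves of the tree are distributed over the two sides of the edge, and each side gains at
  most its end of the edge as a new leaf.
\<close>

lemma card_leaves_opposite_branches:
  assumes "subtree S" "(v, u) \<in> edges S"
  shows "card (leaves (branch S v u)) + card (leaves (branch S u v)) \<le> card (leaves S) + 2"
proof -
  have uv: "(u, v) \<in> edges S" using assms edges_commute by blast
  have fin: "finite (leaves S)" using assms finite_subtree finite_leaves by blast
  have "card (leaves (branch S v' u')) \<le> card (leaves S \<inter> branch S v' u') + 1"
    if e: "(v', u') \<in> edges S" for v' u'
  proof -
    have "card (leaves (branch S v' u')) \<le> card (insert u' (leaves S \<inter> branch S v' u'))"
      using fin leaves_branch_subset[OF assms(1) e] by (intro card_mono) auto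
    also have "\<dots> \<le> card (leaves S \<inter> branch S v' u') + 1"
      using fin by (simp add: card_insert_if)
    finally show ?thesis .
  qed
  note this[OF assms(2)] this[OF uv]
  moreover have "card (leaves S \<inter> branch S v u) + card (leaves S \<inter> branch S u v) = card (leaves S)"
  proof -
    have "leaves S = (leaves S \<inter> branch S v u) \<union> (leaves S \<inter> branch S u v)"
      using opposite_branches(1)[OF assms] by (auto simp: leaves_def)
    moreover have "(leaves S \<inter> branch S v u) \<inter> (leaves S \<inter> branch S u v) = {}"
      using opposite_branches(2)[OF assms] by blast
    ultimately show ?thesis
      using fin card_Un_disjoint[of "leaves S \<inter> branch S v u" "leaves S \<inter> branch S u v"] by simp
  qed
  ultimately show ?thesis by linarith
qed

lemma card_branch_eq_1_iff:
  assumes "subtree S" "(v, u) \<in> edges S"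
  shows "card (branch S v u) = 1 \<longleftrightarrow> u \<in> leaves S"
proof -
  have vu: "v \<in> S" "u \<in> S" "(v, u) \<in> E" "v \<noteq> u" and S: "S \<subseteq> V"
    using assms irrefl_E by (auto simp: in_edges_iff subtree_def)
  have u: "u \<in> branch S v u" using vu by (auto intro: self_in_component)
  have tree: "subtree (branch S v u)" using S vu by (intro subtree_component) auto
  have fin: "finite (branch S v u)" using tree finite_subtree by blast
  have nb: "nbrs S u = insert v (nbrs (branch S v u) u)" "v \<notin> nbrs (branch S v u) u"
    using nbrs_branch[OF assms u] component_subset[of "S - {v}" u] by (auto simp: nbrs_def)
  have "card (nbrs S u) = Suc (card (nbrs (branch S v u) u))"
    using nb finite_nbrs[OF fin] by simp
  moreover have "card (nbrs (branch S v u) u) = 0 \<longleftrightarrow> card (branch S v u) = 1"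
  proof
    assume "card (branch S v u) = 1"
    then have "branch S v u = {u}" using u by (auto simp: card_1_singleton_iff)
    then show "card (nbrs (branch S v u) u) = 0" using irrefl_E by (auto simp: nbrs_def)
  next
    assume "card (nbrs (branch S v u) u) = 0"
    then have "\<not> 2 \<le> card (branch S v u)" using degree_pos[OF tree _ u] by linarith
    then show "card (branch S v u) = 1" using card_subtree_pos[OF tree] by linarith
  qed
  ultimately show ?thesis using vu unfolding leaves_def by simp
qed

lemma leaves_singleton:
  assumes "card S = 1"
  shows "leaves S = {}"
proof -
  obtain x where x: "S = {x}" using assms card_1_singletonE by blast
  then have "nbrs S x = {}" using irrefl_E by (simp add: nbrs_def)
  then show ?thesis using x by (simp add: leaves_def)
qed

lemma subtree_branch:
  assumes "subtree S" "(v, u) \<in> edges S"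
  shows "subtree (branch S v u)"
proof (rule subtree_component)
  show "S - {v} \<subseteq> V" using assms(1) by (auto simp: subtree_def)
  have "v \<noteq> u" using assms(2) irrefl_E[of v] by (auto simp: in_edges_iff)
  then show "u \<in> S - {v}" using assms(2) by (simp add: in_edges_iff)
qed

section \<open>Leaf ratios of the branches\<close>

definition leaf_ratio :: "'a set \<Rightarrow> real" where
  "leaf_ratio S = card (leaves S) / card S"

lemma leaf_ratio_le_1:
  assumes "subtree S"
  shows "leaf_ratio S \<le> 1"
  using card_leaves_le[OF finite_subtree[OF assms]] card_subtree_pos[OF assms]
  by (simp add: leaf_ratio_def)

lemma leaf_ratio_singleton: "card S = 1 \<Longrightarrow> leaf_ratio S = 0"
  by (simp add: leaf_ratio_def leaves_singleton)

text \<open>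
  At an edge that ends in a leaf, one side is a single vertex with leaf ratio 0, and the trivial
  bound 1 suffices for the other side. At any other edge both sides have at least two
  vertices, and the tree has at least two vertices that are not leaves. The indicators make the
  two cases into one expression that can be summed over all edges; its two subtracted
  terms never apply at once, as an edge between two leaves would be the whole tree.
\<close>

lemma leaf_ratio_opposite_branches:
  assumes "subtree S" "(v, u) \<in> edges S" "3 \<le> card S"
  shows "leaf_ratio (branch S v u) + leaf_ratio (branch S u v)
    \<le> 1 + card (leaves S) / (real (card S) - 2) * (1 - of_bool (v \<in> leaves S) - of_bool (u \<in> leaves S))"
proof -
  have uv: "(u, v) \<in> edges S" using assms edges_commute by blast
  note t = subtree_branch[OF assms(1,2)] subtree_branch[OF assms(1) uv]
  note sum_eq = card_opposite_branches[OF assms(1,2)]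
  note c1 = card_branch_eq_1_iff[OF assms(1,2)] card_branch_eq_1_iff[OF assms(1) uv]
  have fin: "finite S" using assms finite_subtree by blast
  consider "u \<in> leaves S" "v \<in> leaves S" | "u \<in> leaves S" "v \<notin> leaves S"
    | "u \<notin> leaves S" "v \<in> leaves S" | "u \<notin> leaves S" "v \<notin> leaves S" by blast
  then show ?thesis
  proof cases
    case 1
    then show ?thesis using c1 sum_eq assms by simp
  next
    case 2
    then show ?thesis using leaf_ratio_singleton[of "branch S v u"] c1(1) leaf_ratio_le_1[OF t(2)] by simp
  next
    case 3
    then show ?thesis using leaf_ratio_singleton[of "branch S u v"] c1(2) leaf_ratio_le_1[OF t(1)] by simp
  next
    case 4
    have two: "2 \<le> card (branch S v u)" "2 \<le> card (branch S u v)"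
      using 4 c1 card_subtree_pos[OF t(1)] card_subtree_pos[OF t(2)] by linarith+
    have "{u, v} \<subseteq> S - leaves S" using 4 assms by (auto simp: in_edges_iff)
    moreover have "u \<noteq> v" using assms(2) irrefl_E[of v] by (auto simp: in_edges_iff)
    ultimately have "2 \<le> card (S - leaves S)"
      using fin card_mono[of "S - leaves S" "{u, v}"] by auto
    then have "card (leaves S) + 2 \<le> card S"
      using fin card_leaves_le[OF fin] by (subst (asm) card_Diff_subset) (auto simp: leaves_def)
    moreover have "real (card S) = card (branch S v u) + card (branch S u v)"
      using sum_eq by simp
    ultimately have "leaf_ratio (branch S v u) + leaf_ratio (branch S u v)
       \<le> 1 + card (leaves S) / (real (card (branch S v u)) + real (card (branch S u v)) - 2)"
      unfolding leaf_ratio_def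
      using two card_leaves_opposite_branches[OF assms(1,2)]
        card_leaves_le[OF finite_subtree[OF t(1)]] card_leaves_le[OF finite_subtree[OF t(2)]]
      by (intro two_sides_ratio_bound) simp_all
    then show ?thesis using 4 \<open>real (card S) = _\<close> by simp
  qed
qed

text \<open>
  Summing over opposite branches; of the \<open>2 (n - 1)\<close> directed edges, twice the number of leaves
  have a leaf as an end.
\<close>

lemma sum_leaf_ratio_branches:
  assumes "subtree S" "3 \<le> card S"
  shows "(\<Sum>(v, u)\<in>edges S. leaf_ratio (branch S v u))
    \<le> (real (card S) - 1) + card (leaves S) / (real (card S) - 2) * (real (card S) - 1 - card (leaves S))"
proof -
  have fin: "finite S" using assms finite_subtree by blast
  let ?L = "real (card (leaves S))" and ?n = "real (card S)"
  have "2 * (\<Sum>(v, u)\<in>edges S. leaf_ratio (branch S v u))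
     = (\<Sum>(v, u)\<in>edges S. leaf_ratio (branch S v u) + leaf_ratio (branch S u v))"
    using sum_edges_commute[of "\<lambda>v u. leaf_ratio (branch S v u)" S]
    by (simp add: case_prod_beta sum.distrib)
  also have "\<dots> \<le> (\<Sum>(v, u)\<in>edges S. 1 + ?L / (?n - 2) *
       (1 - of_bool (v \<in> leaves S) - of_bool (u \<in> leaves S)))"
    using leaf_ratio_opposite_branches[OF assms(1) _ assms(2)] by (intro sum_mono) auto
  also have "\<dots> = card (edges S) + ?L / (?n - 2) * (card (edges S) - 2 * ?L)"
    using sum_leaf_tails[OF fin, where 'b = real] sum_leaf_heads[OF fin, where 'b = real]
    by (simp add: case_prod_beta sum.distrib sum_subtractf
        flip: sum_distrib_left sum_divide_distrib)
  also have "\<dots> = 2 * ((?n - 1) + ?L / (?n - 2) * (?n - 1 - ?L))"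
  proof -
    have "real (card (edges S)) = 2 * (?n - 1)"
      using card_subtree_pos[OF assms(1)] by (simp add: card_edges[OF assms(1)] of_nat_diff)
    moreover have "2 * a + c * (2 * a - 2 * b) = 2 * (a + c * (a - b))" for a b c :: real
      by (simp add: algebra_simps)
    ultimately show ?thesis by (simp only:)
  qed
  finally show ?thesis by simp
qed

lemma sum_card_branches_real:
  assumes "subtree S"
  shows "(\<Sum>(v, u)\<in>edges S. real (card (branch S v u))) = real (card S) * (real (card S) - 1)"
  using arg_cong[OF sum_card_branches[OF assms], of real] card_subtree_pos[OF assms]
  by (simp add: case_prod_beta of_nat_diff)

lemma card_branch_less:
  assumes "subtree S" "(v, u) \<in> edges S"
  shows "card (branch S v u) < card S"
  using card_opposite_branches[OF assms] card_subtree_pos[OF subtree_branch[OF assms(1)]]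
    assms(2) edges_commute[of v u S] by fastforce

section \<open>The recursion for the advantage\<close>

text \<open>
  The argument uses only the recursion below, so it is carried out for any function \<open>A\<close> that
  satisfies it. In the game, \<open>A S\<close> is \<open>|S|\<close> times the difference between the winning
  probabilities of the two players on \<open>S\<close>.
\<close>

context
  fixes A :: "'a set \<Rightarrow> real"
  assumes rec: "\<And>S. subtree S \<Longrightarrow> A S = 1 - (\<Sum>(v, u)\<in>edges S. A (branch S v u)) / card S"
begin

lemma singleton_value:
  assumes "subtree S" "card S = 1"
  shows "A S = 1"
proof -
  have "edges S = {}"
    using card_edges[OF assms(1)] assms(2) finite_edges[OF finite_subtree[OF assms(1)]] by simp
  then show ?thesis using rec[OF assms(1)] by simp
qed

text \<open>
  Every branch of size at least 2 contributes at most \<open>2/15\<close> times its size. Branches of size 1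
  contribute 1, which exceeds this by \<open>13/15\<close>, and there is one of them for each leaf of \<open>S\<close>. The
  excess accounts for the leaf ratio in the bound. For a single vertex the
  bound is the exact value 1.
\<close>

lemma advantage_lower_step:
  assumes S: "subtree S"
    and upper: "\<And>v u. (v, u) \<in> edges S \<Longrightarrow> 2 \<le> card (branch S v u) \<Longrightarrow>
      A (branch S v u) \<le> 2/15 * card (branch S v u)"
  shows "17/15 - 13/15 * leaf_ratio S - 2/15 * card S \<le> A S"
proof -
  let ?n = "real (card S)" and ?L = "real (card (leaves S))"
  have n: "1 \<le> ?n" using card_subtree_pos[OF S] by simp
  have "(\<Sum>(v, u)\<in>edges S. A (branch S v u))
      \<le> (\<Sum>(v, u)\<in>edges S. 2/15 * card (branch S v u) + 13/15 * of_bool (u \<in> leaves S))"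
  proof (rule sum_mono, clarify)
    fix v u assume e: "(v, u) \<in> edges S"
    note iff = card_branch_eq_1_iff[OF S e] and t = subtree_branch[OF S e]
    show "A (branch S v u) \<le> 2/15 * card (branch S v u) + 13/15 * of_bool (u \<in> leaves S)"
    proof (cases "u \<in> leaves S")
      case True
      then show ?thesis using iff singleton_value[OF t] by simp
    next
      case False
      then show ?thesis using iff card_subtree_pos[OF t] upper[OF e] by simp
    qed
  qed
  also have "\<dots> = 2/15 * (?n * (?n - 1)) + 13/15 * ?L"
    using sum_card_branches_real[OF S] sum_leaf_heads[OF finite_subtree[OF S], where 'b = real]
    by (simp add: case_prod_beta sum.distrib flip: sum_distrib_left sum_divide_distrib)
  finally have "(\<Sum>(v, u)\<in>edges S. A (branch S v u)) / ?n
      \<le> (2/15 * (?n * (?n - 1)) + 13/15 * ?L) / ?n"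
    using n by (intro divide_right_mono) auto
  also have "\<dots> = 2/15 * (?n - 1) + 13/15 * leaf_ratio S"
    using n by (simp add: leaf_ratio_def field_simps)
  finally have "1 - (2/15 * (?n - 1) + 13/15 * leaf_ratio S) \<le> A S"
    unfolding rec[OF S] by (rule diff_left_mono)
  then show ?thesis by (simp add: field_simps)
qed

text \<open>
  For at most four vertices the lower bound shows that all branches have nonnegative advantage:
  the bound vanishes for two vertices, and for three there are at most two leaves. The
  single-vertex branches, of which there are at least two, then already suffice.
\<close>

lemma advantage_upper_small:
  assumes S: "subtree S" "2 \<le> card S" "card S \<le> 4"
    and lower: "\<And>v u. (v, u) \<in> edges S \<Longrightarrow>
      17/15 - 13/15 * leaf_ratio (branch S v u) - 2/15 * card (branch S v u) \<le> A (branch S v u)"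
  shows "A S < 2/15 * card S"
proof -
  let ?n = "real (card S)" and ?L = "real (card (leaves S))"
  have "?L = (\<Sum>(v, u)\<in>edges S. of_bool (u \<in> leaves S))"
    using sum_leaf_heads[OF finite_subtree[OF S(1)], where 'b = real] by simp
  also have "\<dots> \<le> (\<Sum>(v, u)\<in>edges S. A (branch S v u))"
  proof (rule sum_mono, clarify)
    fix v u assume e: "(v, u) \<in> edges S"
    note iff = card_branch_eq_1_iff[OF S(1) e] and t = subtree_branch[OF S(1) e]
    have "card (branch S v u) \<le> 3" using card_branch_less[OF S(1) e] S by simp
    then consider "card (branch S v u) = 1" | "card (branch S v u) = 2" | "card (branch S v u) = 3"
      using card_subtree_pos[OF t] by linarith
    then show "of_bool (u \<in> leaves S) \<le> A (branch S v u)"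
    proof cases
      case 1
      then show ?thesis using iff singleton_value[OF t] by simp
    next
      case 2
      then show ?thesis using iff leaf_ratio_le_1[OF t] lower[OF e] by simp
    next
      case 3
      then have "leaf_ratio (branch S v u) \<le> 2/3"
        using card_leaves_less[OF t] by (simp add: leaf_ratio_def)
      then show ?thesis using iff 3 lower[OF e] by simp
    qed
  qed
  finally have "2 \<le> (\<Sum>(v, u)\<in>edges S. A (branch S v u))"
    using two_leaves[OF S(1,2)] by simp
  then have "A S \<le> 1 - 2 / ?n"
    using rec[OF S(1)] S(2) by (simp add: divide_right_mono)
  moreover have "1 - 2 / ?n < 2/15 * ?n"
  proof -
    consider "card S = 2" | "card S = 3" | "card S = 4" using S by linarith
    then show ?thesis by cases simp_all
  qed
  ultimately show ?thesis by linarith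
qed

text \<open>
  For each branch \<open>C\<close>, \<open>A C\<close> exceeds \<open>-2/15 |C|\<close> by at least \<open>17/15 - 13/15 * leaf_ratio C\<close>. There are \<open>2 (n - 1)\<close>
  branches, and by \<open>sum_leaf_ratio_branches\<close> their leaf ratios are on average sufficiently
  small that these excesses sum to more than \<open>13/15 n\<close>. The required inequality is a quadratic
  one that holds from \<open>n = 5\<close> on.
\<close>

lemma advantage_upper_large:
  assumes S: "subtree S" "5 \<le> card S"
    and lower: "\<And>v u. (v, u) \<in> edges S \<Longrightarrow>
      17/15 - 13/15 * leaf_ratio (branch S v u) - 2/15 * card (branch S v u) \<le> A (branch S v u)"
  shows "A S < 2/15 * card S"
proof -
  define n where "n = real (card S)"
  define l where "l = real (card (leaves S))"
  define r where "r = (\<Sum>(v, u)\<in>edges S. leaf_ratio (branch S v u))"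
  have n: "5 \<le> n" using S by (simp add: n_def)
  have "l / (n - 2) * (n - 1 - l) = l * (n - 1 - l) / (n - 2)" by simp
  also have "\<dots> \<le> ((n - 1)\<^sup>2 / 4) / (n - 2)"
  proof (rule divide_right_mono)
    have "0 \<le> (n - 1 - 2 * l)\<^sup>2" by simp
    then show "l * (n - 1 - l) \<le> (n - 1)\<^sup>2 / 4" by (simp add: power2_eq_square algebra_simps)
  qed (use n in simp)
  also have "\<dots> < (8 * n - 21) / 13"
  proof -
    \<comment> \<open>The claim amounts to \<open>19 n^2 - 122 n + 155 > 0\<close>, and this polynomial is \<open>(n - 5) (19 n - 27) + 20\<close>.\<close>
    have "0 \<le> (n - 5) * (19 * n - 27)" using n by (intro mult_nonneg_nonneg) auto
    then have "13 * (n - 1)\<^sup>2 < 4 * (8 * n - 21) * (n - 2)"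
      by (simp add: power2_eq_square algebra_simps)
    then show ?thesis using n by (simp add: field_simps)
  qed
  finally have mixed: "l / (n - 2) * (n - 1 - l) < (8 * n - 21) / 13" .
  have "r \<le> (n - 1) + l / (n - 2) * (n - 1 - l)"
    unfolding n_def l_def r_def using S(2) by (intro sum_leaf_ratio_branches[OF S(1)]) simp
  also have "\<dots> < (n - 1) + (8 * n - 21) / 13"
    by (rule add_strict_left_mono[OF mixed])
  finally have "0 < 13/15 * ((n - 1) + (8 * n - 21) / 13 - r)"
    by (intro mult_pos_pos; linarith)
  also have "\<dots> = 17/15 * (2 * (n - 1)) - 13/15 * r - 2/15 * (n * (n - 1)) - n * (1 - 2/15 * n)"
    by (simp add: field_simps)
  finally have "n * (1 - 2/15 * n) < 17/15 * (2 * (n - 1)) - 13/15 * r - 2/15 * (n * (n - 1))"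
    by simp
  also have "\<dots> = (\<Sum>(v, u)\<in>edges S.
      17/15 - 13/15 * leaf_ratio (branch S v u) - 2/15 * card (branch S v u))"
    using sum_card_branches_real[OF S(1)] card_edges[OF S(1)] S(2)
    by (simp add: n_def r_def of_nat_diff case_prod_beta sum_subtractf
        flip: sum_distrib_left sum_divide_distrib)
  also have "\<dots> \<le> (\<Sum>(v, u)\<in>edges S. A (branch S v u))"
    using lower by (intro sum_mono) auto
  finally have "n * (1 - 2/15 * n) < (\<Sum>(v, u)\<in>edges S. A (branch S v u))" .
  then have "1 - 2/15 * n < (\<Sum>(v, u)\<in>edges S. A (branch S v u)) / n"
    using n by (simp add: pos_less_divide_eq mult.commute)
  then show ?thesis using rec[OF S(1)] by (simp add: n_def)
qed

text \<open>
  The two bounds have to be proved together, as each player's advantage on \<open>S\<close> is limited by what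
  the opponent gets on the branches. The lower bound needs its constant surplus and its
  dependence on the leaf ratio: with \<open>-2/15 |C|\<close> alone for the branches \<open>C\<close>, the upper bound
  would not reproduce itself.
\<close>

lemma advantage_bounds:
  assumes "subtree S"
  shows "17/15 - 13/15 * leaf_ratio S - 2/15 * card S \<le> A S
    \<and> (2 \<le> card S \<longrightarrow> A S < 2/15 * card S)"
  using assms
proof (induction "card S" arbitrary: S rule: less_induct)
  case less
  have IH: "17/15 - 13/15 * leaf_ratio (branch S v u) - 2/15 * card (branch S v u) \<le> A (branch S v u)"
      "2 \<le> card (branch S v u) \<Longrightarrow> A (branch S v u) < 2/15 * card (branch S v u)"
    if "(v, u) \<in> edges S" for v u
    using less.hyps[OF card_branch_less[OF less.prems that] subtree_branch[OF less.prems that]]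
    by auto
  have "17/15 - 13/15 * leaf_ratio S - 2/15 * card S \<le> A S"
    using IH(2) by (intro advantage_lower_step[OF less.prems] less_imp_le)
  moreover have "A S < 2/15 * card S" if "2 \<le> card S"
  proof (cases "card S \<le> 4")
    case True
    then show ?thesis using IH(1) that by (intro advantage_upper_small[OF less.prems])
  next
    case False
    then show ?thesis using IH(1) by (intro advantage_upper_large[OF less.prems]) auto
  qed
  ultimately show ?case by blast
qed

corollary advantage_abs_bound:
  assumes S: "subtree S" "2 \<le> card S"
  shows "\<bar>A S\<bar> < 2/15 * card S"
proof -
  have "17/15 - 13/15 * leaf_ratio S - 2/15 * card S \<le> A S" "A S < 2/15 * card S"
    using advantage_bounds[OF S(1)] S(2) by auto
  then show ?thesis using leaf_ratio_le_1[OF S(1)] by linarith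
qed

end

text \<open>
  Passing from a fixed target to all targets: exchange the sums over the target and the first
  guess \<open>v\<close>, and group the targets different from \<open>v\<close> by the branch at \<open>v\<close> that contains them.
\<close>

lemma sum_targets_recursion:
  fixes D :: "'a set \<Rightarrow> 'a \<Rightarrow> real"
  assumes rec: "\<And>S t. S \<subseteq> V \<Longrightarrow> t \<in> S \<Longrightarrow>
      D S t = (1 - (\<Sum>v\<in>S - {t}. D (component (S - {v}) t) t)) / card S"
    and S: "subtree S"
  shows "(\<Sum>t\<in>S. D S t)
    = 1 - (\<Sum>(v, u)\<in>edges S. \<Sum>t\<in>branch S v u. D (branch S v u) t) / card S"
proof -
  have fin: "finite S" and SV: "S \<subseteq> V" using S finite_subtree by (auto simp: subtree_def)
  have n: "card S \<noteq> 0" using card_subtree_pos[OF S] by simp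
  have "(\<Sum>t\<in>S. \<Sum>v\<in>S - {t}. D (component (S - {v}) t) t)
      = (\<Sum>t\<in>S. \<Sum>v\<in>{v\<in>S. v \<noteq> t}. D (component (S - {v}) t) t)"
    by (intro sum.cong) auto
  also have "\<dots> = (\<Sum>v\<in>S. \<Sum>t\<in>{t\<in>S. v \<noteq> t}. D (component (S - {v}) t) t)"
    by (rule sum.swap_restrict[OF fin fin])
  also have "\<dots> = (\<Sum>v\<in>S. \<Sum>t\<in>S - {v}. D (component (S - {v}) t) t)"
    by (intro sum.cong) auto
  also have "\<dots> = (\<Sum>v\<in>S. \<Sum>u\<in>nbrs S v. \<Sum>t\<in>branch S v u. D (component (S - {v}) t) t)"
    by (intro sum.cong refl sum_over_branches[OF S, symmetric])
  also have "\<dots> = (\<Sum>(v, u)\<in>edges S. \<Sum>t\<in>branch S v u. D (branch S v u) t)"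
    using component_eq by (simp add: sum_edges[OF fin] cong: sum.cong)
  finally have swap: "(\<Sum>t\<in>S. \<Sum>v\<in>S - {t}. D (component (S - {v}) t) t)
      = (\<Sum>(v, u)\<in>edges S. \<Sum>t\<in>branch S v u. D (branch S v u) t)" .
  have "(\<Sum>t\<in>S. D S t) = (\<Sum>t\<in>S. (1 - (\<Sum>v\<in>S - {t}. D (component (S - {v}) t) t)) / card S)"
    using rec[OF SV] by (intro sum.cong) auto
  also have "\<dots> = (card S - (\<Sum>t\<in>S. \<Sum>v\<in>S - {t}. D (component (S - {v}) t) t)) / card S"
    by (simp add: sum_subtractf flip: sum_divide_distrib)
  finally show ?thesis using n swap by (simp add: diff_divide_distrib)
qed

end

section \<open>From the game to the recursion\<close>

lemma del_vert_induce: "pre_digraph.del_vert (T \<restriction> S) v = T \<restriction> (S - {v})"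
  by (auto simp: pre_digraph.del_vert_def induce_subgraph_def)

lemma induce_induce: "S' \<subseteq> S \<Longrightarrow> (T \<restriction> S) \<restriction> S' = T \<restriction> S'"
  by (auto simp: induce_subgraph_def)

lemma (in wf_digraph) induce_verts: "G \<restriction> verts G = G"
  by (intro pre_digraph.equality) auto

lemma (in wf_digraph) reachable_induce_iff:
  "u \<rightarrow>\<^sup>*\<^bsub>G \<restriction> S\<^esub> w \<longleftrightarrow> (u, w) \<in> rtrancl_on S (arcs_ends G)"
proof
  assume "u \<rightarrow>\<^sup>*\<^bsub>G \<restriction> S\<^esub> w"
  then show "(u, w) \<in> rtrancl_on S (arcs_ends G)"
    unfolding reachable_def
    by (induction rule: rtrancl_on_induct)
       (auto intro: rtrancl_on_into_rtrancl_on dest: dominates_induce_subgraphD)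
next
  assume "(u, w) \<in> rtrancl_on S (arcs_ends G)"
  then show "u \<rightarrow>\<^sup>*\<^bsub>G \<restriction> S\<^esub> w"
    unfolding reachable_def
  proof (induction rule: rtrancl_on_induct)
    case (step y z)
    then have "(y, z) \<in> arcs_ends (G \<restriction> S)" by (auto simp: arcs_ends_conv)
    then show ?case using step by (auto intro: rtrancl_on_into_rtrancl_on)
  qed simp
qed

text \<open>
  A path from \<open>u\<close> to \<open>u'\<close> that avoids \<open>v\<close> closes up, through \<open>v\<close>, to a cycle. As \<open>u\<close> and \<open>u'\<close> are
  distinct, the path has at least one arc, so the cycle has length at least 3 and is not one of the
  spurious cycles that traverse an edge back and forth.
\<close>

lemma undirected_tree_no_bypass:
  assumes "graph T" and no_cycle: "\<not> (\<exists>p. pre_digraph.cycle T p \<and> length p \<ge> 3)"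
    and e: "(v, u) \<in> arcs_ends T" "(v, u') \<in> arcs_ends T" "u \<noteq> u'"
  shows "(u, u') \<notin> rtrancl_on (verts T - {v}) (arcs_ends T)"
proof
  interpret graph T by fact
  assume "(u, u') \<in> rtrancl_on (verts T - {v}) (arcs_ends T)"
  then have reach: "u \<rightarrow>\<^sup>*\<^bsub>T \<restriction> (verts T - {v})\<^esub> u'" by (simp add: reachable_induce_iff)
  let ?H = "T \<restriction> (verts T - {v})"
  interpret H: wf_digraph ?H by (rule wellformed_induce_subgraph)
  obtain p where p: "H.apath u p u'" using reach H.reachable_apath by blast
  have verts: "H.awalk_verts u p = awalk_verts u p"
    by (simp add: compatible_awalk_verts[OF compatible_induce_subgraph])
  have pH: "H.awalk u p u'" "distinct (awalk_verts u p)"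
    using p verts by (auto simp: H.apath_def)
  have walk: "awalk u p u'"
    using pH(1) compatible_cas[OF compatible_induce_subgraph, of T "verts T - {v}"]
    by (auto simp: pre_digraph.awalk_def)
  have "set (awalk_verts u p) \<subseteq> verts ?H"
    using H.awalk_verts_in_verts pH(1) verts by (metis H.awalkE H.awalk_verts_in_verts subsetI)
  then have v: "v \<notin> set (awalk_verts u p)" by auto
  obtain e1 where e1: "e1 \<in> arcs T" "tail T e1 = v" "head T e1 = u" using e(1) by blast
  have "(u', v) \<in> arcs_ends T" using e(2) arcs_ends_symmetric[OF sym_arcs] by blast
  then obtain e2 where e2: "e2 \<in> arcs T" "tail T e2 = u'" "head T e2 = v" by blast
  have "p \<noteq> []" using walk e(3) by auto
  let ?q = "e1 # p @ [e2]"
  have walk2: "awalk u (p @ [e2]) v" using walk e2 by (auto simp: awalk_simps)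
  then have "awalk v ?q v" using e1 by (auto simp: awalk_Cons_iff)
  moreover have "distinct (tl (awalk_verts v ?q))"
    using pH(2) v e1 e2 awalk_verts_append[OF walk2] by simp
  ultimately have "cycle ?q" by (auto simp: cycle_def)
  moreover have "3 \<le> length ?q" using \<open>p \<noteq> []\<close> by (cases p) auto
  ultimately show False using no_cycle by blast
qed

lemma finite_forest_undirected_tree:
  assumes "undirected_tree T"
  shows "finite_forest (verts T) (arcs_ends T)"
proof -
  interpret graph T using assms by (simp add: undirected_tree_def)
  show ?thesis
  proof
    show "sym (arcs_ends T)" using sym_arcs by (simp add: symmetric_def)
    show "(v, v) \<notin> arcs_ends T" for v using adj_not_same by blast
    show "(u, u') \<notin> rtrancl_on (verts T - {v}) (arcs_ends T)"
      if "(v, u) \<in> arcs_ends T" "(v, u') \<in> arcs_ends T" "u \<noteq> u'" for v u u'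
      using undirected_tree_no_bypass[OF graph_axioms] assms that
      by (simp add: undirected_tree_def)
  qed simp
qed

lemma subtree_undirected_tree:
  assumes "undirected_tree T"
  shows "finite_forest.subtree (verts T) (arcs_ends T) (verts T)"
proof -
  interpret graph T using assms by (simp add: undirected_tree_def)
  interpret finite_forest "verts T" "arcs_ends T"
    by (rule finite_forest_undirected_tree[OF assms])
  have "(arcs_ends T)\<^sup>s = arcs_ends T" using sym_E by (auto simp: symcl_def dest: symD)
  then show ?thesis
    using assms connected_conv by (auto simp: undirected_tree_def subtree_def)
qed

lemma component_of_induce:
  assumes "undirected_tree T"
  shows "component_of (pre_digraph.del_vert (T \<restriction> S) v) t
    = T \<restriction> finite_forest.component (arcs_ends T) (S - {v}) t"
proof -
  interpret graph T using assms by (simp add: undirected_tree_def)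
  interpret finite_forest "verts T" "arcs_ends T"
    by (rule finite_forest_undirected_tree[OF assms])
  have "pre_digraph.scc_of (T \<restriction> (S - {v})) t = component (S - {v}) t"
    using reach_commute by (auto simp: pre_digraph.scc_of_def reachable_induce_iff component_def)
  then show ?thesis
    using component_subset by (simp add: component_of_def del_vert_induce induce_induce)
qed

text \<open>
  The difference between the winning probabilities of the two players when the target is \<open>t\<close>.
  Passing the move to the opponent only changes its sign.
\<close>

definition target_advantage :: "('a, 'b) pre_digraph \<Rightarrow> 'a \<Rightarrow> real" where
  "target_advantage T t = 2 * pmf (random_play T t) True - 1"

text \<open>
  The guess \<open>v = t\<close> contributes 1, and after any other guess the roles of the players are exchanged.
\<close>

lemma target_advantage_rec:
  assumes T: "undirected_tree T" and S: "S \<subseteq> verts T" "t \<in> S"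
  shows "target_advantage (T \<restriction> S) t = (1 - (\<Sum>v\<in>S - {t}.
    target_advantage (T \<restriction> finite_forest.component (arcs_ends T) (S - {v}) t) t)) / card S"
proof -
  interpret graph T using T by (simp add: undirected_tree_def)
  have fin: "finite S" using S finite_verts finite_subset by blast
  let ?R = "\<lambda>v. random_play (T \<restriction> finite_forest.component (arcs_ends T) (S - {v}) t) t"
  have flip: "pmf (map_pmf Not p) True = 1 - pmf p True" for p
    using pmf_map_inj'[of Not p False] by (simp add: pmf_False_conv_True inj_def)
  have "pmf (random_play (T \<restriction> S) t) True
      = (\<Sum>v\<in>S. pmf (if v = t then return_pmf True else map_pmf Not (?R v)) True) / card S"
  proof -
    have "S \<noteq> {}" using S by blast
    then show ?thesis
      unfolding random_play.simps[of "T \<restriction> S"] component_of_induce[OF T]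
      using fin S by (simp add: pmf_bind_pmf_of_set)
  qed
  also have "(\<Sum>v\<in>S. pmf (if v = t then return_pmf True else map_pmf Not (?R v)) True)
      = 1 + (\<Sum>v\<in>S - {t}. pmf (map_pmf Not (?R v)) True)"
    using fin S by (subst sum.remove[of _ t]) (auto intro!: sum.cong)
  finally have "pmf (random_play (T \<restriction> S) t) True
      = (1 + (\<Sum>v\<in>S - {t}. 1 - pmf (?R v) True)) / card S"
    by (simp add: flip)
  moreover have "card S \<noteq> 0" using fin S by auto
  moreover have "real (card (S - {t})) = real (card S) - 1"
    using fin S \<open>card S \<noteq> 0\<close> by (cases "card S") simp_all
  ultimately show ?thesis
    unfolding target_advantage_def
    by (simp add: sum_subtractf field_simps flip: sum_distrib_left)
qed

lemma first_player_win_prob_eq: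
  assumes "finite (verts T)" "verts T \<noteq> {}"
  shows "first_player_win_prob T
    = 1/2 + (\<Sum>t\<in>verts T. target_advantage T t) / (2 * card (verts T))"
proof -
  have "card (verts T) \<noteq> 0" using assms by simp
  moreover have "first_player_win_prob T = (\<Sum>t\<in>verts T. pmf (random_play T t) True) / card (verts T)"
    using assms by (simp add: first_player_win_prob_def measure_pmf_single pmf_bind_pmf_of_set)
  ultimately show ?thesis
    by (simp add: target_advantage_def sum_subtractf field_simps flip: sum_distrib_left)
qed

theorem theorem5p4:
  fixes T :: "('a, 'b) pre_digraph" and n :: nat
  assumes "undirected_tree T"
    and "n = card (verts T)"
    and "n \<ge> 2"
  shows "13/30 < first_player_win_prob T \<and> first_player_win_prob T < 17/30"
proof -
  interpret graph T using assms by (simp add: undirected_tree_def)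
  interpret finite_forest "verts T" "arcs_ends T"
    by (rule finite_forest_undirected_tree[OF assms(1)])
  define A where "A = (\<lambda>S. \<Sum>t\<in>S. target_advantage (T \<restriction> S) t)"
  have "A S = 1 - (\<Sum>(v, u)\<in>edges S. A (branch S v u)) / card S" if "subtree S" for S
    unfolding A_def by (rule sum_targets_recursion[OF target_advantage_rec[OF assms(1)] that])
  then have "\<bar>A (verts T)\<bar> < 2/15 * n"
    using advantage_abs_bound[of A "verts T"] subtree_undirected_tree[OF assms(1)] assms(2,3)
    by simp
  moreover have "first_player_win_prob T = 1/2 + A (verts T) / (2 * n)"
  proof -
    have "verts T \<noteq> {}" using assms(2,3) by auto
    then show ?thesis using first_player_win_prob_eq[of T] assms(2) by (simp add: A_def induce_verts)
  qed
  moreover have "A (verts T) / (2 * n) < 1/15" "- (1/15) < A (verts T) / (2 * n)"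
    using calculation(1) assms(3) by (simp_all add: abs_less_iff field_simps)
  ultimately show ?thesis by linarith
qed

end
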